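(* For any complex numbers $a,b$, define $$L(a,b)=(q,a,b;q)_\infty\sum_{n=0}^\infty\frac{(ab/q^2;q)_{2n}}{(q,a,b,ab/q^2;q)_n}\,q^n.$$ Then $$\theta(q,a)=L(a,b)+b\,L(aq,bq).$$
   Context: Here $q$ is a fixed complex number with $0<|q|<1$, and parameters are assumed to be such that no denominator vanishes. Notation: $(x;q)_\infty=\prod_{n\ge0}(1-xq^n)$, $(x;q)_n=(x;q)_\infty/(xq^n;q)_\infty$, and $(a_1,\ldots,a_m;q)_n=(a_1;q)_n\cdots(a_m;q)_n$ for $n$ an integer or $\infty$. The partial theta function is $\theta(q,x)=\sum_{n=0}^\infty\tau(n)x^n$ with $\tau(n)=(-1)^nq^{n(n-1)/2}$. *)

theory Defs
  imports "HOL-Analysis.Analysis"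
begin

definition qpoch_inf :: "complex \<Rightarrow> complex \<Rightarrow> complex"
  where "qpoch_inf q x = (\<Prod>n. 1 - x * q ^ n)"

text \<open>
  For integer \<open>n\<close>. The quotient is only meaningful when its denominator is nonzero, that is,
  when \<open>x * q powi (n + k) \<noteq> 1\<close> for all natural \<open>k\<close>.
\<close>
definition qpoch :: "complex \<Rightarrow> complex \<Rightarrow> int \<Rightarrow> complex"
  where "qpoch q x n = qpoch_inf q x / qpoch_inf q (x * q powi n)"

definition qpochs_inf :: "complex \<Rightarrow> complex list \<Rightarrow> complex"
  where "qpochs_inf q xs = (\<Prod>x\<leftarrow>xs. qpoch_inf q x)"

definition qpochs :: "complex \<Rightarrow> complex list \<Rightarrow> int \<Rightarrow> complex"
  where "qpochs q xs n = (\<Prod>x\<leftarrow>xs. qpoch q x n)"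

definition tau :: "complex \<Rightarrow> nat \<Rightarrow> complex"
  where "tau q n = (-1) ^ n * q ^ (n * (n - 1) div 2)"

definition partial_theta :: "complex \<Rightarrow> complex \<Rightarrow> complex"
  where "partial_theta q x = (\<Sum>n. tau q n * x ^ n)"

definition L :: "complex \<Rightarrow> complex \<Rightarrow> complex \<Rightarrow> complex"
  where "L q a b =
    qpochs_inf q [q, a, b] *
    (\<Sum>n. qpoch q (a * b / q\<^sup>2) (int (2 * n)) / qpochs q [q, a, b, a * b / q\<^sup>2] (int n) * q ^ n)"

end

theory Submission
  imports Defs
begin

text \<open>
  Put \<open>F(a,b) = L(a,b) + b L(aq,bq)\<close>. The partial theta function satisfies
  \<open>\<theta>(q,a) = 1 - a \<theta>(q,aq)\<close>, and iterating this relation determines it: a function that satisfies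
  it along \<open>a, aq, aq\<^sup>2, \<dots>\<close> and is bounded there agrees with \<open>\<theta>\<close>, since the error after \<open>N\<close> steps
  carries the factor \<open>\<tau>(N) a\<^sup>N\<close>, which tends to \<open>0\<close> (lemma \<open>partial_theta_eq_bounded_solution\<close>). So
  it is enough that \<open>F\<close> is bounded on the points \<open>(aq\<^sup>N, bq\<^sup>N)\<close> and that
  \<open>F(a,b) = 1 - a F(aq,bq)\<close>. That \<open>b\<close> moves along with \<open>a\<close> is what makes this work: written out,
  the relation is
  \[ L(a,b) + (a+b) L(aq,bq) + abq L(aq^2,bq^2) = 1, \]
  which is symmetric in \<open>a\<close> and \<open>b\<close> (lemma \<open>L_recurrence\<close>).

  This recurrence telescopes. With \<open>c = ab\<close>, divide by \<open>(q,a,b;q)\<^sub>\<infinity>\<close> and delay the second series by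
  one index and the third by two, so that the summands of index \<open>n\<close> have the common
  denominator \<open>(q,a,b;q)\<^sub>n\<close>. Their combined partial sum is then the single product
  \[ \frac{(cq^N;q)_N}{(q,a,b;q)_N}, \]
  which tends to \<open>1/(q,a,b;q)\<^sub>\<infinity>\<close>. The induction step is a polynomial identity
  (lemma \<open>telescoped_partial_sums\<close>).

  Absorbing \<open>(q,a,b;q)\<^sub>\<infinity>\<close> into the series writes each summand of \<open>L\<close> through the infinite products
  \<open>(xq\<^sup>k;q)\<^sub>\<infinity>\<close> alone. As functions of \<open>k\<close> these never vanish and tend to \<open>1\<close>, so they and their
  inverses are bounded, which gives convergence and the required bound at once
  (lemma \<open>L_term_bounded\<close>).
\<close>

section \<open>Tails of the infinite product\<close>

lemma convergent_prod_qpoch_inf: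
  fixes q x :: complex
  assumes "norm q < 1"
  shows "convergent_prod (\<lambda>n. 1 - x * q ^ n)"
proof -
  have "summable (\<lambda>n. norm (1 - x * q ^ n - 1))"
    using assms by (simp add: norm_mult norm_power summable_mult)
  then show ?thesis
    by (intro abs_convergent_prod_imp_convergent_prod summable_imp_abs_convergent_prod)
qed

text \<open>
  For \<open>\<bar>q\<bar> < 1\<close> this says that \<open>(x;q)\<^sub>\<infinity>\<close> is nonzero; stated factor by factor it passes at once
  to \<open>xq\<^sup>j\<close>.
\<close>
definition regular :: "complex \<Rightarrow> complex \<Rightarrow> bool"
  where "regular q x \<longleftrightarrow> (\<forall>k. x * q ^ k \<noteq> 1)"

definition qtail :: "complex \<Rightarrow> complex \<Rightarrow> nat \<Rightarrow> complex"
  where "qtail q x k = qpoch_inf q (x * q ^ k)"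

lemma regular_shift: "regular q x \<Longrightarrow> regular q (x * q ^ j)"
  by (auto simp: regular_def mult.assoc simp flip: power_add)

lemma regular_base:
  assumes "norm q < 1"
  shows "regular q q"
proof -
  have "q * q ^ k \<noteq> 1" for k
  proof
    assume "q * q ^ k = 1"
    then have "norm q ^ Suc k = 1"
      by (metis norm_one norm_power power_Suc)
    then show False
      using assms power_Suc_le_self[of "norm q" k] by simp
  qed
  then show ?thesis by (simp add: regular_def)
qed

lemma qtail_shift: "qtail q (x * q ^ j) k = qtail q x (j + k)"
  by (simp add: qtail_def power_add mult.assoc)

lemma qtail_nonzero:
  assumes "norm q < 1" "regular q x"
  shows "qtail q x k \<noteq> 0"
  unfolding qtail_def qpoch_inf_def
  using assms regular_shift[OF assms(2), of k]
  by (intro prodinf_nonzero convergent_prod_qpoch_inf) (auto simp: regular_def)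

lemma qtail_Suc:
  assumes "norm q < 1" "regular q x"
  shows "qtail q x k = (1 - x * q ^ k) * qtail q x (Suc k)"
proof -
  let ?f = "\<lambda>n. 1 - x * q ^ k * q ^ n"
  have "prodinf (\<lambda>n. ?f (Suc n)) = prodinf ?f / ?f 0"
    by (intro prodinf_split_head convergent_prod_qpoch_inf assms)
      (use assms in \<open>auto simp: regular_def\<close>)
  then show ?thesis
    using assms(2) by (simp add: qtail_def qpoch_inf_def regular_def mult_ac)
qed

text \<open>
  The partial products of \<open>(x;q)\<^sub>\<infinity>\<close> equal \<open>(x;q)\<^sub>\<infinity> / (xq\<^sup>k;q)\<^sub>\<infinity>\<close> and converge to the nonzero value
  \<open>(x;q)\<^sub>\<infinity>\<close>, so the denominators converge to \<open>1\<close>.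
\<close>
lemma qtail_tendsto_1:
  assumes "norm q < 1" "regular q x"
  shows "qtail q x \<longlonglongrightarrow> 1"
proof -
  have "(\<Prod>i<k. 1 - x * q ^ i) * qtail q x k = qtail q x 0" for k
    by (induction k) (simp_all add: mult.assoc flip: qtail_Suc[OF assms])
  then have prod: "(\<Prod>i<k. 1 - x * q ^ i) = qtail q x 0 / qtail q x k" for k
    using qtail_nonzero[OF assms] by (simp add: nonzero_eq_divide_eq)
  have "(\<lambda>k. \<Prod>i\<le>k. 1 - x * q ^ i) \<longlonglongrightarrow> qtail q x 0"
    using convergent_prod_LIMSEQ[OF convergent_prod_qpoch_inf[OF assms(1), of x]]
    by (simp add: qtail_def qpoch_inf_def)
  then have "(\<lambda>k. \<Prod>i<Suc k. 1 - x * q ^ i) \<longlonglongrightarrow> qtail q x 0"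
    by (simp only: lessThan_Suc_atMost)
  then have "(\<lambda>k. qtail q x 0 / qtail q x k) \<longlonglongrightarrow> qtail q x 0"
    unfolding prod by (rule LIMSEQ_imp_Suc)
  then have "(\<lambda>k. qtail q x 0 / (qtail q x 0 / qtail q x k)) \<longlonglongrightarrow> qtail q x 0 / qtail q x 0"
    by (intro tendsto_divide tendsto_const) (auto simp: qtail_nonzero assms)
  then show ?thesis
    using qtail_nonzero[OF assms] by simp
qed

section \<open>The series L without finite shifted factorials\<close>

text \<open>
  The summand of \<open>L\<close> with the prefactor absorbed: \<open>(x;q)\<^sub>\<infinity> / (x;q)\<^sub>n\<close> is \<open>(xq\<^sup>n;q)\<^sub>\<infinity>\<close> for
  \<open>x = q, a, b\<close>, and the quotient of the two tails in \<open>d = ab/q\<^sup>2\<close> is \<open>(d;q)\<^sub>2\<^sub>n / (d;q)\<^sub>n\<close>.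
\<close>
definition L_term :: "complex \<Rightarrow> complex \<Rightarrow> complex \<Rightarrow> nat \<Rightarrow> complex"
  where "L_term q a b n = q ^ n * (qtail q q n * qtail q a n * qtail q b n *
    (qtail q (a * b / q\<^sup>2) n / qtail q (a * b / q\<^sup>2) (2 * n)))"

definition admissible :: "complex \<Rightarrow> complex \<Rightarrow> complex \<Rightarrow> bool"
  where "admissible q a b \<longleftrightarrow> 0 < norm q \<and> norm q < 1 \<and>
    regular q a \<and> regular q b \<and> regular q (a * b / q\<^sup>2)"

lemma product_shift: "a * q ^ N * (b * q ^ N) / q\<^sup>2 = a * b / q\<^sup>2 * q ^ (2 * N)"
  for q :: complex
  by (simp add: power_mult power2_eq_square mult_ac)

lemma admissible_shift:
  assumes "admissible q a b"
  shows "admissible q (a * q ^ N) (b * q ^ N)"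
  using assms unfolding admissible_def product_shift by (blast intro: regular_shift)

lemma L_term_shift:
  "L_term q (a * q ^ N) (b * q ^ N) n = q ^ n * (qtail q q n *
    qtail q a (N + n) * qtail q b (N + n) *
    (qtail q (a * b / q\<^sup>2) (2 * N + n) / qtail q (a * b / q\<^sup>2) (2 * N + 2 * n)))"
  unfolding L_term_def product_shift qtail_shift by simp

text \<open>
  One constant serves for all shifts \<open>N\<close>, because shifting only moves the indices of the
  tails, and convergent sequences are bounded over all indices.
\<close>
lemma L_term_bounded:
  assumes "admissible q a b"
  obtains M where "\<And>N n. norm (L_term q (a * q ^ N) (b * q ^ N) n) \<le> M * norm q ^ n"
proof -
  let ?d = "a * b / q\<^sup>2"
  have q: "norm q < 1" and reg: "regular q q" "regular q a" "regular q b" "regular q ?d"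
    using assms regular_base by (auto simp: admissible_def)
  have bounded: "\<exists>K. \<forall>k. norm (f k) \<le> K" if "f \<longlonglongrightarrow> l" for f :: "nat \<Rightarrow> complex" and l
    using convergent_imp_Bseq[OF convergentI[OF that]] by (auto elim!: BseqE)
  note lim = qtail_tendsto_1[OF q]
  obtain K1 where K1: "\<And>k. norm (qtail q q k) \<le> K1" using bounded[OF lim[OF reg(1)]] by blast
  obtain K2 where K2: "\<And>k. norm (qtail q a k) \<le> K2" using bounded[OF lim[OF reg(2)]] by blast
  obtain K3 where K3: "\<And>k. norm (qtail q b k) \<le> K3" using bounded[OF lim[OF reg(3)]] by blast
  obtain K4 where K4: "\<And>k. norm (qtail q ?d k) \<le> K4" using bounded[OF lim[OF reg(4)]] by blast
  have "(\<lambda>k. inverse (qtail q ?d k)) \<longlonglongrightarrow> inverse 1"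
    by (intro tendsto_inverse lim reg) simp
  then obtain K5 where K5: "\<And>k. norm (inverse (qtail q ?d k)) \<le> K5"
    using bounded by blast
  note K = K1 K2 K3 K4
  have pos: "0 \<le> K1" "0 \<le> K2" "0 \<le> K3" "0 \<le> K4" "0 \<le> K5"
    by (rule order_trans[OF norm_ge_zero] K K5)+
  have "norm (L_term q (a * q ^ N) (b * q ^ N) n) \<le> (K1 * K2 * K3 * (K4 * K5)) * norm q ^ n" for N n
  proof -
    have "norm (qtail q q n) * norm (qtail q a (N + n)) * norm (qtail q b (N + n)) *
        (norm (qtail q ?d (2 * N + n)) * norm (inverse (qtail q ?d (2 * N + 2 * n))))
      \<le> K1 * K2 * K3 * (K4 * K5)"
      by (intro mult_mono K K5) (simp_all add: pos)
    then have "norm q ^ n * (norm (qtail q q n) * norm (qtail q a (N + n)) * norm (qtail q b (N + n)) *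
        (norm (qtail q ?d (2 * N + n)) * norm (inverse (qtail q ?d (2 * N + 2 * n)))))
      \<le> norm q ^ n * (K1 * K2 * K3 * (K4 * K5))"
      by (rule mult_left_mono) simp
    then show ?thesis
      unfolding L_term_shift norm_mult norm_power divide_inverse[of "qtail q ?d (2 * N + n)"]
      by (simp only: mult.commute[of "norm q ^ n"])
  qed
  then show ?thesis by (rule that)
qed

lemma summable_L_term:
  assumes "admissible q a b"
  shows "summable (L_term q a b)"
proof -
  obtain M where M: "\<And>N n. norm (L_term q (a * q ^ N) (b * q ^ N) n) \<le> M * norm q ^ n"
    using L_term_bounded[OF assms] by blast
  show ?thesis
  proof (rule summable_comparison_test')
    show "summable (\<lambda>n. M * norm q ^ n)"
      using assms by (simp add: admissible_def summable_mult)
    show "norm (L_term q a b n) \<le> M * norm q ^ n" if "0 \<le> n" for n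
      using M[of 0 n] by simp
  qed
qed

lemma L_eq_suminf:
  assumes "admissible q a b"
  shows "L q a b = suminf (L_term q a b)"
proof -
  let ?d = "a * b / q\<^sup>2"
  have q: "norm q < 1" and reg: "regular q q" "regular q a" "regular q b" "regular q ?d"
    using assms regular_base by (auto simp: admissible_def)
  note nz = qtail_nonzero[OF q reg(1)] qtail_nonzero[OF q reg(2)] qtail_nonzero[OF q reg(3)]
    qtail_nonzero[OF q reg(4)]
  have inf: "qpoch_inf q x = qtail q x 0" for x
    by (simp add: qtail_def)
  have fin: "qpoch q x (int n) = qtail q x 0 / qtail q x n" for x n
    by (simp add: qtail_def qpoch_def)
  let ?C = "qpochs_inf q [q, a, b]"
  have C: "?C \<noteq> 0"
    using nz by (simp add: qpochs_inf_def inf)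
  have "qpoch q ?d (int (2 * n)) / qpochs q [q, a, b, ?d] (int n) * q ^ n
      = inverse ?C * L_term q a b n" for n
    unfolding qpochs_def qpochs_inf_def fin inf L_term_def list.map prod_list.Cons prod_list.Nil
    using nz by (simp add: divide_simps)
  then have "L q a b = ?C * (\<Sum>n. inverse ?C * L_term q a b n)"
    by (simp add: L_def)
  also have "\<dots> = suminf (L_term q a b)"
    using C by (simp add: suminf_mult summable_L_term assms)
  finally show ?thesis .
qed

lemma L_bounded:
  assumes "admissible q a b"
  shows "\<exists>K. \<forall>N. norm (L q (a * q ^ N) (b * q ^ N)) \<le> K"
proof -
  obtain M where M: "\<And>N n. norm (L_term q (a * q ^ N) (b * q ^ N) n) \<le> M * norm q ^ n"
    using L_term_bounded[OF assms] by blast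
  have "summable (\<lambda>n. M * norm q ^ n)"
    using assms by (simp add: admissible_def summable_mult)
  then have "norm (L q (a * q ^ N) (b * q ^ N)) \<le> (\<Sum>n. M * norm q ^ n)" for N
    unfolding L_eq_suminf[OF admissible_shift[OF assms]]
    using M by (intro norm_suminf_le) auto
  then show ?thesis by blast
qed

section \<open>The recurrence for L\<close>

text \<open>
  The right-hand side is \<open>(q,a,b;q)\<^sub>\<infinity> (cq\<^sup>M;q)\<^sub>M / (q,a,b;q)\<^sub>M\<close> with \<open>c = ab\<close> and \<open>M = N + 1\<close>. The unequal
  lengths of the three sums are essential: shifting \<open>a\<close> and \<open>b\<close> by \<open>q\<^sup>j\<close> moves their tails by \<open>j\<close>
  places, and lowering the index by \<open>j\<close> compensates for it. In a step of the induction the three new summands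
  and both values of the right-hand side are then polynomials in \<open>q\<^sup>N\<close> times one common factor.
\<close>
lemma telescoped_partial_sums:
  assumes "admissible q a b"
  shows "(\<Sum>n<N + 2. L_term q a b n) + (a + b) * (\<Sum>n<N + 1. L_term q (a * q) (b * q) n)
      + a * b * q * (\<Sum>n<N. L_term q (a * q\<^sup>2) (b * q\<^sup>2) n)
    = qtail q q (N + 1) * qtail q a (N + 1) * qtail q b (N + 1) *
      (qtail q (a * b / q\<^sup>2) (N + 3) / qtail q (a * b / q\<^sup>2) (2 * N + 4))"
proof -
  define d where "d = a * b / q\<^sup>2"
  have q: "norm q < 1" "q \<noteq> 0" and reg: "regular q q" "regular q a" "regular q b" "regular q d"
    using assms regular_base by (auto simp: admissible_def d_def)
  have ab: "a * b = d * q\<^sup>2"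
    using q by (simp add: d_def)
  note nz = qtail_nonzero[OF q(1) reg(4)]
  note S = qtail_Suc[OF q(1) reg(1)] qtail_Suc[OF q(1) reg(2)] qtail_Suc[OF q(1) reg(3)]
     qtail_Suc[OF q(1) reg(4)]
  have T0: "L_term q a b n = q ^ n * (qtail q q n * qtail q a n * qtail q b n *
    (qtail q d n / qtail q d (2 * n)))" for n
    by (simp add: L_term_def d_def)
  have T1: "L_term q (a * q) (b * q) n = q ^ n * (qtail q q n * qtail q a (n + 1) * qtail q b (n + 1) *
    (qtail q d (n + 2) / qtail q d (2 * n + 2)))" for n
    using L_term_shift[of q a 1 b n] by (simp add: d_def)
  have T2: "L_term q (a * q\<^sup>2) (b * q\<^sup>2) n = q ^ n * (qtail q q n * qtail q a (n + 2) * qtail q b (n + 2) *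
    (qtail q d (n + 4) / qtail q d (2 * n + 4)))" for n
    using L_term_shift[of q a 2 b n] by (simp add: d_def add.commute)
  show ?thesis unfolding d_def[symmetric]
  proof (induction N)
    case 0
    define P where "P = qtail q q 1 * qtail q a 1 * qtail q b 1"
    have t00: "L_term q a b 0 = (1 - q) * (1 - a) * (1 - b) * P"
      using S(1)[of 0] S(2)[of 0] S(3)[of 0] nz by (simp add: T0 P_def)
    have t01: "L_term q a b 1 = q * (1 - d * q) * P"
      using S(4)[of 1] nz[of 2] by (simp add: T0 P_def numeral_2_eq_2)
    have t10: "L_term q (a * q) (b * q) 0 = (1 - q) * P"
      using S(1)[of 0] nz by (simp add: T1 P_def)
    have new: "qtail q q 1 * qtail q a 1 * qtail q b 1 * (qtail q d 3 / qtail q d 4)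
        = (1 - d * q ^ 3) * P"
      using S(4)[of 3] nz[of 4] by (simp add: P_def eval_nat_numeral)
    have key: "(1 - q) * (1 - a) * (1 - b) + q * (1 - d * q) + (a + b) * (1 - q) = 1 - d * q ^ 3"
      using ab by algebra
    have "L_term q a b 0 + L_term q a b 1 + (a + b) * L_term q (a * q) (b * q) 0
        = (1 - d * q ^ 3) * P"
      unfolding t00 t01 t10 key[symmetric] by (simp only: distrib_right mult.assoc)
    then show ?case
      using new by (simp add: numeral_2_eq_2)
  next
    case (Suc N)
    define x where "x = q ^ N"
    \<comment> \<open>The factor common to the new summands and to both values of the right-hand side.\<close>
    define P where "P = qtail q q (N + 2) * qtail q a (N + 2) * qtail q b (N + 2) *
      (qtail q d (N + 4) / qtail q d (2 * N + 4))"
    have first: "qtail q y (N + 1) = (1 - y * q * x) * qtail q y (N + 2)" if "regular q y" for y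
      using qtail_Suc[OF q(1) that, of "N + 1"] by (simp add: x_def mult_ac)
    have zeroth: "qtail q q N = (1 - q * x) * ((1 - q * q * x) * qtail q q (N + 2))"
      using S(1)[of N] first[OF reg(1)] by (simp add: x_def)
    have third: "qtail q d (N + 3) = (1 - d * q ^ 3 * x) * qtail q d (N + 4)"
      using S(4)[of "N + 3"] by (simp add: x_def power_add mult_ac eval_nat_numeral)
    have second: "qtail q d (N + 2) = (1 - d * q\<^sup>2 * x) * ((1 - d * q ^ 3 * x) * qtail q d (N + 4))"
      using S(4)[of "N + 2"] third by (simp add: x_def power_add mult_ac eval_nat_numeral)
    have double: "qtail q d (2 * N + 4) =
        (1 - d * q ^ 4 * x\<^sup>2) * ((1 - d * q ^ 5 * x\<^sup>2) * qtail q d (2 * N + 6))"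
      using S(4)[of "2 * N + 4"] S(4)[of "2 * N + 5"]
      by (simp add: x_def power_add mult_ac eval_nat_numeral power_mult)
    have t0: "L_term q a b (N + 2) = q\<^sup>2 * x * (1 - d * q\<^sup>2 * x) * (1 - d * q ^ 3 * x) * P"
    proof -
      have "2 * (N + 2) = 2 * N + 4" by simp
      then show ?thesis
        unfolding T0 by (simp only: second P_def x_def power_add mult_ac times_divide_eq_right)
    qed
    have t1: "L_term q (a * q) (b * q) (N + 1) = q * x * (1 - q\<^sup>2 * x) * (1 - d * q ^ 3 * x) * P"
      unfolding T1 using first[OF reg(1)] third
      by (simp add: P_def x_def mult_ac power2_eq_square eval_nat_numeral)
    have t2: "L_term q (a * q\<^sup>2) (b * q\<^sup>2) N = x * (1 - q * x) * (1 - q\<^sup>2 * x) * P"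
      unfolding T2 zeroth by (simp add: P_def x_def mult_ac power2_eq_square)
    have old: "qtail q q (N + 1) * qtail q a (N + 1) * qtail q b (N + 1) *
        (qtail q d (N + 3) / qtail q d (2 * N + 4))
      = (1 - q\<^sup>2 * x) * (1 - a * q * x) * (1 - b * q * x) * (1 - d * q ^ 3 * x) * P"
      unfolding first[OF reg(1)] first[OF reg(2)] first[OF reg(3)] third
      by (simp add: P_def mult_ac power2_eq_square)
    have new: "qtail q q (N + 2) * qtail q a (N + 2) * qtail q b (N + 2) *
        (qtail q d (N + 4) / qtail q d (2 * N + 6))
      = (1 - d * q ^ 4 * x\<^sup>2) * (1 - d * q ^ 5 * x\<^sup>2) * P"
    proof -
      have "1 - d * q ^ 4 * x\<^sup>2 \<noteq> 0" "1 - d * q ^ 5 * x\<^sup>2 \<noteq> 0"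
        using double nz[of "2 * N + 4"] by auto
      then show ?thesis
        unfolding P_def double using nz[of "2 * N + 6"] by simp
    qed
    have key: "(1 - q\<^sup>2 * x) * (1 - a * q * x) * (1 - b * q * x) * (1 - d * q ^ 3 * x)
      + q\<^sup>2 * x * (1 - d * q\<^sup>2 * x) * (1 - d * q ^ 3 * x)
      + (a + b) * (q * x * (1 - q\<^sup>2 * x) * (1 - d * q ^ 3 * x))
      + a * b * q * (x * (1 - q * x) * (1 - q\<^sup>2 * x))
      = (1 - d * q ^ 4 * x\<^sup>2) * (1 - d * q ^ 5 * x\<^sup>2)"
      using ab by algebra
    have "(\<Sum>n<Suc N + 2. L_term q a b n)
        + (a + b) * (\<Sum>n<Suc N + 1. L_term q (a * q) (b * q) n)
        + a * b * q * (\<Sum>n<Suc N. L_term q (a * q\<^sup>2) (b * q\<^sup>2) n)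
      = (\<Sum>n<N + 2. L_term q a b n) + (a + b) * (\<Sum>n<N + 1. L_term q (a * q) (b * q) n)
        + a * b * q * (\<Sum>n<N. L_term q (a * q\<^sup>2) (b * q\<^sup>2) n)
        + (L_term q a b (N + 2) + (a + b) * L_term q (a * q) (b * q) (N + 1)
        + a * b * q * L_term q (a * q\<^sup>2) (b * q\<^sup>2) N)"
      unfolding add_Suc sum.lessThan_Suc distrib_left by (simp only: add_ac)
    also have "\<dots> = (1 - d * q ^ 4 * x\<^sup>2) * (1 - d * q ^ 5 * x\<^sup>2) * P"
      unfolding Suc.IH old t0 t1 t2 key[symmetric] by (simp only: distrib_right mult.assoc add.assoc)
    also have "\<dots> = qtail q q (Suc N + 1) * qtail q a (Suc N + 1) * qtail q b (Suc N + 1) *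
      (qtail q d (Suc N + 3) / qtail q d (2 * Suc N + 4))"
      unfolding new[symmetric] by (simp add: eval_nat_numeral)
    finally show ?case .
  qed
qed

lemma L_recurrence:
  assumes "admissible q a b"
  shows "L q a b + (a + b) * L q (a * q) (b * q) + a * b * q * L q (a * q\<^sup>2) (b * q\<^sup>2) = 1"
proof -
  let ?d = "a * b / q\<^sup>2"
  have q: "norm q < 1" and reg: "regular q q" "regular q a" "regular q b" "regular q ?d"
    using assms regular_base by (auto simp: admissible_def)
  have adm: "admissible q (a * q) (b * q)" "admissible q (a * q\<^sup>2) (b * q\<^sup>2)"
    using admissible_shift[OF assms, of 1] admissible_shift[OF assms, of 2] by simp_all
  have part: "(\<lambda>N. \<Sum>n<N + k. L_term q a' b' n) \<longlonglongrightarrow> L q a' b'"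
    if "admissible q a' b'" for a' b' k
    unfolding L_eq_suminf[OF that]
    by (intro LIMSEQ_ignore_initial_segment summable_LIMSEQ summable_L_term that)
  have tail: "(\<lambda>N. qtail q x (N + k)) \<longlonglongrightarrow> 1" if "regular q x" for x k
    by (intro LIMSEQ_ignore_initial_segment qtail_tendsto_1 q that)
  have tail2: "(\<lambda>N. qtail q ?d (2 * N + 4)) \<longlonglongrightarrow> 1"
    using LIMSEQ_subseq_LIMSEQ[OF tail[OF reg(4), of 4], of "\<lambda>N. 2 * N"]
    by (simp add: strict_mono_def o_def)
  have "(\<lambda>N. (\<Sum>n<N + 2. L_term q a b n) + (a + b) * (\<Sum>n<N + 1. L_term q (a * q) (b * q) n)
      + a * b * q * (\<Sum>n<N + 0. L_term q (a * q\<^sup>2) (b * q\<^sup>2) n))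
    \<longlonglongrightarrow> L q a b + (a + b) * L q (a * q) (b * q) + a * b * q * L q (a * q\<^sup>2) (b * q\<^sup>2)"
    by (intro tendsto_intros part assms adm)
  moreover have "(\<lambda>N. qtail q q (N + 1) * qtail q a (N + 1) * qtail q b (N + 1) *
      (qtail q ?d (N + 3) / qtail q ?d (2 * N + 4))) \<longlonglongrightarrow> 1 * 1 * 1 * (1 / 1)"
    by (intro tendsto_mult tendsto_divide tail tail2 reg) simp
  ultimately show ?thesis
    unfolding telescoped_partial_sums[OF assms] add_0_right
    by (simp add: LIMSEQ_unique)
qed

section \<open>Characterising the partial theta function\<close>

lemma tau_Suc: "tau q (Suc n) = - tau q n * q ^ n"
proof -
  have "Suc n * (Suc n - 1) div 2 = n * (n - 1) div 2 + n"
    by (cases n) simp_all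
  then show ?thesis by (simp add: tau_def power_add)
qed

lemma partial_theta_terms_tendsto_0:
  assumes "norm q < 1"
  shows "(\<lambda>n. tau q n * a ^ n) \<longlonglongrightarrow> 0"
proof -
  have "(\<lambda>n. norm (a * q ^ n)) \<longlonglongrightarrow> norm (a * 0)"
    by (intro tendsto_intros LIMSEQ_power_zero assms)
  then have "eventually (\<lambda>n. norm (a * q ^ n) < 1/2) sequentially"
    by (rule order_tendstoD) simp
  then obtain M where M: "\<And>n. n \<ge> M \<Longrightarrow> norm (a * q ^ n) < 1/2"
    by (auto simp: eventually_sequentially)
  have "summable (\<lambda>n. tau q n * a ^ n)"
  proof (rule summable_ratio_test)
    show "(1/2::real) < 1" by simp
    fix n assume "n \<ge> M"
    have "norm (tau q (Suc n) * a ^ Suc n) = norm (a * q ^ n) * norm (tau q n * a ^ n)"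
      by (simp add: tau_Suc norm_mult)
    also have "\<dots> \<le> 1/2 * norm (tau q n * a ^ n)"
      using M[OF \<open>n \<ge> M\<close>] by (intro mult_right_mono) auto
    finally show "norm (tau q (Suc n) * a ^ Suc n) \<le> 1/2 * norm (tau q n * a ^ n)" .
  qed
  then show ?thesis by (rule summable_LIMSEQ_zero)
qed

text \<open>
  Unfolding the recursion \<open>N\<close> times produces the partial sums of \<open>\<theta>(q,a)\<close> and the remainder
  \<open>\<tau>(N) a\<^sup>N F(N)\<close>. The bound on \<open>F\<close> cannot be dropped: adding to a solution a multiple of
  \<open>1/(\<tau>(N) a\<^sup>N)\<close>, for nonzero \<open>q\<close> and \<open>a\<close>, gives another one.
\<close>
lemma partial_theta_eq_bounded_solution:
  assumes q: "norm q < 1"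
    and rec: "\<And>N. F N = 1 - a * q ^ N * F (Suc N)"
    and bound: "\<And>N. norm (F N) \<le> K"
  shows "partial_theta q a = F 0"
proof -
  have expand: "(\<Sum>n<N. tau q n * a ^ n) = F 0 - tau q N * a ^ N * F N" for N
  proof (induction N)
    case 0
    then show ?case by (simp add: tau_def)
  next
    case (Suc N)
    then show ?case
      by (simp add: rec[of N] tau_Suc algebra_simps)
  qed
  have "(\<lambda>N. tau q N * a ^ N * F N) \<longlonglongrightarrow> 0"
    using partial_theta_terms_tendsto_0[OF q] bound
    by (intro lim_null_mult_right_bounded[where f = "\<lambda>N. tau q N * a ^ N" and B = K]) auto
  then have "(\<lambda>N. F 0 - tau q N * a ^ N * F N) \<longlonglongrightarrow> F 0 - 0"
    by (intro tendsto_intros)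
  then have "(\<lambda>n. tau q n * a ^ n) sums F 0"
    by (simp add: sums_def expand)
  then show ?thesis
    by (simp add: partial_theta_def sums_iff)
qed

section \<open>The partial theta function as a combination of two values of L\<close>

theorem theorem1p8:
  fixes q a b :: complex
  assumes "0 < norm q" and "norm q < 1"
    and "\<And>k::nat. a * q ^ k \<noteq> 1"
    and "\<And>k::nat. b * q ^ k \<noteq> 1"
    and "\<And>k::nat. a * b / q\<^sup>2 * q ^ k \<noteq> 1"
  shows "partial_theta q a = L q a b + b * L q (a * q) (b * q)"
proof -
  have adm: "admissible q a b"
    using assms by (simp add: admissible_def regular_def)
  let ?L = "\<lambda>N. L q (a * q ^ N) (b * q ^ N)"
  let ?F = "\<lambda>N. ?L N + b * q ^ N * ?L (Suc N)"
  have "?F N = 1 - a * q ^ N * ?F (Suc N)" for N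
    using L_recurrence[OF admissible_shift[OF adm, of N]]
    by (simp add: algebra_simps power2_eq_square)
  moreover obtain K where K: "\<And>N. norm (?L N) \<le> K"
    using L_bounded[OF adm] by blast
  have "norm (?F N) \<le> K + norm b * 1 * K" for N
    using assms(2) K[of N] K[of "Suc N"]
    by (intro norm_triangle_mono) (auto simp: norm_mult norm_power intro!: mult_mono mult_left_le power_le_one)
  ultimately have "partial_theta q a = ?F 0"
    by (rule partial_theta_eq_bounded_solution[OF assms(2)])
  then show ?thesis by simp
qed

end
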